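(* Let $n_1\le n_2$, let $L$ be a $q\times n_1$ real matrix and $M_0$ a $q\times n_2$ real matrix, and consider the problem $$\min_{X\in\mathbb{R}^{n_1\times n_2}}\ \|X\|_*\quad\text{subject to}\quad LX=M_0,$$ with the linear operator $\Phi X:=LX$. If the linear system $LX=M_0$ is consistent, then at $X_0:=L^\dagger M_0$, with $r=\operatorname{rank}(X_0)$ and $X_0=U_0\Sigma_0V_0^T$ a compact SVD, both of the following hold: (Strict Restricted Injectivity) $\operatorname{Ker}\Phi\cap U_0\mathbb{S}^rV_0^T=\{0\}$; (Nondegenerate Source Condition) $\operatorname{Im}\Phi^*\cap\operatorname{ri}\partial\|X_0\|_*\neq\emptyset$. Consequently, $X_0$ is the strong solution of the problem.
   Context: $\mathbb{R}^{n_1\times n_2}$ carries the inner product $\langle X,Y\rangle=\operatorname{Tr}(X^TY)$ with Frobenius norm $\|\cdot\|_F$; $\|\cdot\|_*$ is the nuclear norm, $\partial\|X_0\|_*$ its convex subdifferential at $X_0$, and $\operatorname{ri}$ denotes relative interior. $L^\dagger$ is the Moore–Penrose inverse of $L$. A compact SVD $X_0=U_0\Sigma_0V_0^T$ has $U_0\in\mathbb{R}^{n_1\times r}$, $V_0\in\mathbb{R}^{n_2\times r}$ with orthonormal columns and $\Sigma_0\in\mathbb{R}^{r\times r}$ diagonal with the positive singular values. $\mathbb{S}^r$ denotes the symmetric $r\times r$ matrices and $U_0\mathbb{S}^rV_0^T=\{U_0AV_0^T\mid A\in\mathbb{S}^r\}$. $X_0$ (feasible) is a strong solution of the problem if there exist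 $c,\varepsilon>0$ with $\|X\|_*-\|X_0\|_*\ge c\|X-X_0\|_F^2$ for all $X$ with $LX=M_0$ and $\|X-X_0\|_F\le\varepsilon$. *)

theory Defs
  imports "HOL-Analysis.Analysis"
begin

text \<open>
  An \<open>m \<times> n\<close> matrix has the type \<^typ>\<open>real^'n^'m\<close>. The inner product and the norm of that
  type are the trace inner product \<open>Tr (X\<^sup>T Y)\<close> (see \<open>inner_eq_trace\<close> below) and the
  Frobenius norm.
\<close>

lemma inner_eq_trace:
  fixes X Y :: "real^'n^'m"
  shows "X \<bullet> Y = trace (transpose X ** Y)"
proof -
  have "X \<bullet> Y = (\<Sum>i\<in>UNIV. \<Sum>j\<in>UNIV. X$i$j * Y$i$j)"
    by (simp add: inner_vec_def)
  also have "\<dots> = (\<Sum>j\<in>UNIV. \<Sum>i\<in>UNIV. X$i$j * Y$i$j)"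
    by (rule sum.swap)
  also have "\<dots> = trace (transpose X ** Y)"
    by (simp add: trace_def matrix_matrix_mult_def transpose_def)
  finally show ?thesis .
qed

text \<open>The four Penrose equations.\<close>

definition is_pinv :: "real^'n^'m \<Rightarrow> real^'m^'n \<Rightarrow> bool" where
  "is_pinv A P \<longleftrightarrow>
     A ** P ** A = A \<and> P ** A ** P = P \<and>
     transpose (A ** P) = A ** P \<and> transpose (P ** A) = P ** A"

definition pinv :: "real^'n^'m \<Rightarrow> real^'m^'n" where
  "pinv A = (THE P. is_pinv A P)"

lemma ex_least_squares_inverse:
  fixes A :: "real^'n^'m"
  obtains G where "A ** G ** A = A" "transpose (A ** G) = A ** G"
proof -
  have normal_eq: "\<exists>x. transpose A *v (A *v x) = transpose A *v y" for y :: "real^'m"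
  proof -
    obtain p z where p: "p \<in> span (range ((*v) A))"
      and z: "\<And>w. w \<in> span (range ((*v) A)) \<Longrightarrow> orthogonal z w" and y: "y = p + z"
      using orthogonal_subspace_decomp_exists[of "range ((*v) A)" y] by metis
    have "span (range ((*v) A)) = range ((*v) A)"
      by (metis linear_subspace_image matrix_vector_mul_linear span_eq_iff subspace_UNIV)
    with p obtain x where x: "p = A *v x" by auto
    have "(transpose A *v z) \<bullet> w = 0" for w
      using z[OF span_base, of "A *v w"]
      by (simp add: orthogonal_def dot_lmul_matrix)
    then have "transpose A *v z = 0"
      by (metis inner_eq_zero_iff)
    then have "transpose A *v (A *v x) = transpose A *v y"
      by (simp add: y x matrix_vector_right_distrib)
    then show ?thesis ..
  qed
  then obtain g where g: "\<And>y. transpose A *v (A *v g y) = transpose A *v y"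
    by metis
  define G :: "real^'m^'n" where "G = (\<chi> i j. g (axis j 1) $ i)"
  have "G *v axis j 1 = g (axis j 1)" for j
    by (simp add: G_def matrix_vector_mult_basis column_def)
  then have "(transpose A ** A ** G) *v axis j 1 = transpose A *v axis j 1" for j
    using g[of "axis j 1"] by (simp add: matrix_vector_mul_assoc[symmetric])
  then have "column j (transpose A ** A ** G) = column j (transpose A)" for j
    by (simp add: matrix_vector_mult_basis)
  then have 1: "transpose A ** A ** G = transpose A"
    by (simp add: column_def vec_eq_iff)
  have 2: "transpose G ** transpose A ** A = A"
    using arg_cong[OF 1, of transpose] by (simp add: matrix_transpose_mul matrix_mul_assoc)
  have "A ** G = transpose G ** transpose A ** A ** G"
    by (simp add: 2)
  also have "\<dots> = transpose G ** transpose A"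
    using 1 by (simp add: matrix_mul_assoc[symmetric])
  finally have 3: "A ** G = transpose G ** transpose A" .
  show thesis
  proof (rule that)
    show "A ** G ** A = A" by (simp add: 3 2)
    show "transpose (A ** G) = A ** G" by (simp add: matrix_transpose_mul 3)
  qed
qed

lemma is_pinv_unique:
  assumes "is_pinv A P" "is_pinv A Q"
  shows "P = Q"
proof -
  have *: "A ** P ** A = A" "P ** A ** P = P" "transpose (A ** P) = A ** P"
    "transpose (P ** A) = P ** A" "A ** Q ** A = A" "Q ** A ** Q = Q"
    "transpose (A ** Q) = A ** Q" "transpose (Q ** A) = Q ** A"
    using assms by (auto simp: is_pinv_def)
  have "A ** P = transpose ((A ** Q) ** (A ** P))"
    using *(3,5) by (simp add: matrix_mul_assoc)
  also have "\<dots> = (A ** P) ** (A ** Q)"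
    by (subst matrix_transpose_mul) (simp only: *)
  finally have AP: "A ** P = A ** Q"
    using *(1) by (simp add: matrix_mul_assoc)
  have "P ** A = transpose ((P ** A) ** (Q ** A))"
    using *(4,5) by (metis matrix_mul_assoc)
  also have "\<dots> = (Q ** A) ** (P ** A)"
    by (subst matrix_transpose_mul) (simp only: *)
  finally have PA: "P ** A = Q ** A"
    using *(1) by (metis matrix_mul_assoc)
  have "P = P ** (A ** P)" using *(2) by (simp add: matrix_mul_assoc)
  also have "\<dots> = Q ** A ** Q" by (simp add: AP PA matrix_mul_assoc)
  finally show ?thesis using *(6) by simp
qed

lemma is_pinv_pinv: "is_pinv A (pinv A)"
proof -
  obtain G where G: "A ** G ** A = A" "transpose (A ** G) = A ** G"
    by (rule ex_least_squares_inverse)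
  obtain H where H: "transpose A ** H ** transpose A = transpose A"
      "transpose (transpose A ** H) = transpose A ** H"
    by (rule ex_least_squares_inverse)
  define K where "K = transpose H"
  have K: "A ** K ** A = A" "transpose (K ** A) = K ** A"
    using arg_cong[OF H(1), of transpose] H(2)
    by (simp_all add: K_def matrix_transpose_mul matrix_mul_assoc)
  have 1: "A ** (K ** A ** G) = A ** G"
    using K(1) by (simp add: matrix_mul_assoc)
  have 2: "(K ** A ** G) ** A = K ** A"
    using G(1) by (metis matrix_mul_assoc)
  have "is_pinv A (K ** A ** G)"
    unfolding is_pinv_def 1 2
    using G K by (simp add: matrix_mul_assoc) (metis K(1) matrix_mul_assoc)
  then show ?thesis
    unfolding pinv_def by (metis is_pinv_unique theI)
qed

definition gram_eigenspace :: "real^'n^'m \<Rightarrow> real \<Rightarrow> (real^'n) set" where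
  "gram_eigenspace X t = {v. (transpose X ** X) *v v = t *\<^sub>R v}"

definition pos_singular_values :: "real^'n^'m \<Rightarrow> real set" where
  "pos_singular_values X = {s. s > 0 \<and> (\<exists>v. v \<noteq> 0 \<and> v \<in> gram_eigenspace X (s\<^sup>2))}"

lemma finite_pos_singular_values: "finite (pos_singular_values X)"
proof -
  define S where "S = pos_singular_values X"
  have "\<forall>s\<in>S. \<exists>v. v \<noteq> 0 \<and> v \<in> gram_eigenspace X (s\<^sup>2)"
    by (simp add: S_def pos_singular_values_def)
  then obtain v where v: "\<And>s. s \<in> S \<Longrightarrow> v s \<noteq> 0 \<and> v s \<in> gram_eigenspace X (s\<^sup>2)"
    by metis
  have orth: "v s \<bullet> v t = 0" if "s \<in> S" "t \<in> S" "s \<noteq> t" for s t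
  proof -
    have "s\<^sup>2 * (v s \<bullet> v t) = ((transpose X ** X) *v v s) \<bullet> v t"
      using v[OF that(1)] by (simp add: gram_eigenspace_def)
    also have "\<dots> = v s \<bullet> ((transpose X ** X) *v v t)"
      by (metis dot_lmul_matrix matrix_transpose_mul transpose_matrix_vector transpose_transpose)
    also have "\<dots> = t\<^sup>2 * (v s \<bullet> v t)"
      using v[OF that(2)] by (simp add: gram_eigenspace_def)
    finally have "s\<^sup>2 = t\<^sup>2 \<or> v s \<bullet> v t = 0" by auto
    moreover have "s\<^sup>2 \<noteq> t\<^sup>2"
      using that by (auto simp: S_def pos_singular_values_def power2_eq_iff)
    ultimately show ?thesis by simp
  qed
  have "inj_on v S"
    using orth v by (metis inj_onI inner_eq_zero_iff)
  moreover have "pairwise orthogonal (v ` S)"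
    using orth by (auto simp: pairwise_def orthogonal_def)
  then have "finite (v ` S)"
    by (rule pairwise_orthogonal_imp_finite)
  ultimately show ?thesis
    unfolding S_def by (metis finite_imageD)
qed

text \<open>
  The sum of the singular values counted with multiplicity. The multiplicity of \<open>s\<close> is that of
  the eigenvalue \<open>s\<^sup>2\<close> of \<open>X\<^sup>T X\<close>. Zero singular values contribute nothing, so only the positive
  ones occur.
\<close>

definition nuclear_norm :: "real^'n^'m \<Rightarrow> real" where
  "nuclear_norm X = (\<Sum>s\<in>pos_singular_values X. s * real (dim (gram_eigenspace X (s\<^sup>2))))"

definition subdifferential :: "('a::real_inner \<Rightarrow> real) \<Rightarrow> 'a \<Rightarrow> 'a set" where
  "subdifferential f x = {s. \<forall>y. f y \<ge> f x + s \<bullet> (y - x)}"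

text \<open>
  The number of columns \<open>r\<close> of \<open>U\<close> and \<open>V\<close> depends on the matrix that is decomposed and may be
  \<open>0\<close>, so it cannot be the cardinality of an index type. Hence an \<open>m \<times> r\<close> matrix \<open>U\<close> is given by
  its columns \<open>U k\<close>, \<open>k < r\<close>, and an \<open>r \<times> r\<close> matrix \<open>A\<close> by its entries \<open>A k l\<close>, \<open>k, l < r\<close>; the
  values outside these ranges are never used. The following is the product \<open>U A V\<^sup>T\<close>.
\<close>

definition sandwich ::
    "nat \<Rightarrow> (nat \<Rightarrow> real^'m) \<Rightarrow> (nat \<Rightarrow> nat \<Rightarrow> real) \<Rightarrow> (nat \<Rightarrow> real^'n) \<Rightarrow> real^'n^'m" where
  "sandwich r U A V = (\<chi> i j. \<Sum>k<r. \<Sum>l<r. U k $ i * A k l * V l $ j)"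

definition orthonormal_columns :: "nat \<Rightarrow> (nat \<Rightarrow> real^'m) \<Rightarrow> bool" where
  "orthonormal_columns r U \<longleftrightarrow> (\<forall>k<r. \<forall>l<r. U k \<bullet> U l = (if k = l then 1 else 0))"

definition compact_svd ::
    "real^'n^'m \<Rightarrow> nat \<Rightarrow> (nat \<Rightarrow> real^'m) \<Rightarrow> (nat \<Rightarrow> nat \<Rightarrow> real) \<Rightarrow> (nat \<Rightarrow> real^'n) \<Rightarrow> bool" where
  "compact_svd X r U \<Sigma> V \<longleftrightarrow>
     orthonormal_columns r U \<and> orthonormal_columns r V \<and>
     (\<forall>k<r. \<forall>l<r. k \<noteq> l \<longrightarrow> \<Sigma> k l = 0) \<and> (\<forall>k<r. \<Sigma> k k > 0) \<and>
     X = sandwich r U \<Sigma> V"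

text \<open>The set \<open>U \<S>\<^sup>r V\<^sup>T\<close>, where \<open>\<S>\<^sup>r\<close> are the symmetric \<open>r \<times> r\<close> matrices.\<close>

definition sym_sandwiches ::
    "nat \<Rightarrow> (nat \<Rightarrow> real^'m) \<Rightarrow> (nat \<Rightarrow> real^'n) \<Rightarrow> (real^'n^'m) set" where
  "sym_sandwiches r U V = {sandwich r U A V | A. \<forall>k<r. \<forall>l<r. A k l = A l k}"

definition strong_solution :: "('a::real_normed_vector \<Rightarrow> real) \<Rightarrow> 'a set \<Rightarrow> 'a \<Rightarrow> bool" where
  "strong_solution f C x0 \<longleftrightarrow> x0 \<in> C \<and>
     (\<exists>c>0. \<exists>\<epsilon>>0. \<forall>x\<in>C. norm (x - x0) \<le> \<epsilon> \<longrightarrow> f x - f x0 \<ge> c * (norm (x - x0))\<^sup>2)"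

end

theory Submission
  imports Defs
begin

text \<open>
  The nuclear norm is dual to the operator norm: \<open>\<langle>S, X\<rangle> \<le> \<parallel>X\<parallel>\<^sub>*\<close> for every contraction \<open>S\<close>, with
  equality for \<open>S = U V\<^sup>T\<close>. Hence \<open>S\<close> is a subgradient at \<open>X\<^sub>0\<close> exactly if it is a contraction
  with \<open>\<langle>S, X\<^sub>0\<rangle> = \<parallel>X\<^sub>0\<parallel>\<^sub>*\<close>, and \<open>E = U\<^sub>0 V\<^sub>0\<^sup>T\<close> lies in the relative interior. The orthogonal
  projection \<open>P = L\<^sup>\<dagger> L\<close> onto \<open>range L\<^sup>T\<close> fixes \<open>X\<^sub>0\<close>, hence \<open>U\<^sub>0\<close> and everything of the form
  \<open>U\<^sub>0 A V\<^sub>0\<^sup>T\<close>, while it annihilates the kernel of \<open>\<Phi>\<close>; this gives both regularity conditions. Every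
  feasible \<open>X\<^sub>0 + H\<close> satisfies \<open>X\<^sub>0\<^sup>T H = 0\<close>, and testing it against a multiple of \<open>\<parallel>X\<^sub>0\<parallel>\<^sub>* E + H\<close>
  yields \<open>\<parallel>X\<^sub>0 + H\<parallel>\<^sub>* \<ge> sqrt (\<parallel>X\<^sub>0\<parallel>\<^sub>*\<^sup>2 + \<parallel>H\<parallel>\<^sup>2)\<close>, which is the quadratic growth.
\<close>

section \<open>Outer products and orthonormal systems\<close>

definition outer :: "real^'m \<Rightarrow> real^'n \<Rightarrow> real^'n^'m" where
  "outer u v = (\<chi> i j. u $ i * v $ j)"

lemma outer_mult_vec: "outer u v *v w = (v \<bullet> w) *\<^sub>R u"
  by (simp add: outer_def vec_eq_iff matrix_vector_mult_def inner_vec_def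
      sum_distrib_left sum_distrib_right ac_simps)

lemma transpose_outer: "transpose (outer u v) = outer v u"
  by (simp add: outer_def transpose_def vec_eq_iff mult.commute)

lemma matrix_mult_outer: "A ** outer u v = outer (A *v u) v"
  by (simp add: outer_def vec_eq_iff matrix_vector_mult_def matrix_matrix_mult_def
      sum_distrib_left sum_distrib_right ac_simps)

lemma inner_outer: "A \<bullet> outer u v = (A *v v) \<bullet> u"
  by (simp add: outer_def inner_vec_def matrix_vector_mult_def
      sum_distrib_left sum_distrib_right ac_simps)

lemma norm_outer: "norm (outer u v) = norm u * norm v"
proof -
  have "(norm (outer u v))\<^sup>2 = (norm u * norm v)\<^sup>2"
    unfolding power2_norm_eq_inner power_mult_distrib
    by (simp add: inner_outer outer_mult_vec)
  then show ?thesis by simp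
qed

lemma transpose_vec_inner: "(transpose A *v x) \<bullet> y = x \<bullet> (A *v y)"
  for A :: "real^'n^'m"
  by (simp add: dot_lmul_matrix)

lemma linear_matrix_mult_vec: "linear (\<lambda>A. A *v (x::real^'n))"
  by (rule linearI) (auto simp: vec_eq_iff matrix_vector_mult_def sum.distrib sum_distrib_left algebra_simps)

lemma linear_matrix_mult: "linear (\<lambda>X. (A::real^'n^'m) ** (X::real^'p^'n))"
  by (rule linearI) (auto simp: vec_eq_iff matrix_matrix_mult_def sum.distrib sum_distrib_left algebra_simps)

lemma linear_transpose: "linear (transpose :: real^'n^'m \<Rightarrow> _)"
  by (rule linearI) (auto simp: vec_eq_iff transpose_def)

text \<open>Testing \<open>A\<close> against the rank-one matrix with factors \<open>A *v x\<close>
  and \<open>x\<close> reduces the bound to Cauchy-Schwarz: the Frobenius norm dominates the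
  operator norm.\<close>

lemma norm_matrix_vec_le: "norm (A *v x) \<le> norm A * norm x"
  for A :: "real^'n^'m"
proof (cases "A *v x = 0")
  case False
  have "(norm (A *v x))\<^sup>2 = A \<bullet> outer (A *v x) x"
    by (simp add: inner_outer power2_norm_eq_inner)
  also have "\<dots> \<le> norm A * (norm (A *v x) * norm x)"
    by (metis norm_cauchy_schwarz norm_outer)
  finally show ?thesis
    using False by (simp add: power2_eq_square)
qed simp

lemma inner_matrix_mult: "(A ** X) \<bullet> Y = X \<bullet> (transpose A ** Y)"
  for A :: "real^'n^'m" and X :: "real^'p^'n"
  unfolding inner_eq_trace matrix_transpose_mul matrix_mul_assoc by (rule refl)

lemma orthonormal_columnsD:
  assumes "orthonormal_columns r U" "k < r" "l < r"
  shows "U k \<bullet> U l = (if k = l then 1 else 0)"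
  using assms by (simp add: orthonormal_columns_def)

lemma orthonormal_columns_norm:
  assumes "orthonormal_columns r U" "k < r"
  shows "norm (U k) = 1"
  using orthonormal_columnsD[OF assms(1,2,2)] by (simp add: norm_eq_1)

lemma inner_orthonormal_sum:
  assumes "orthonormal_columns r U" "k < r"
  shows "U k \<bullet> (\<Sum>l<r. a l *\<^sub>R U l) = a k"
proof -
  have "U k \<bullet> (\<Sum>l<r. a l *\<^sub>R U l) = (\<Sum>l<r. if k = l then a l else 0)"
    unfolding inner_sum_right using assms by (intro sum.cong) (auto simp: orthonormal_columnsD)
  then show ?thesis using assms by simp
qed

lemma norm_orthonormal_sum:
  assumes "orthonormal_columns r U"
  shows "(norm (\<Sum>l<r. a l *\<^sub>R U l))\<^sup>2 = (\<Sum>l<r. (a l)\<^sup>2)"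
  unfolding power2_norm_eq_inner
  by (subst inner_sum_left) (simp add: inner_orthonormal_sum[OF assms] power2_eq_square)

text \<open>Pythagoras: the sum is the orthogonal projection of \<open>x\<close> onto the span of
  the \<open>V k\<close>.\<close>

lemma bessel_residual:
  assumes "orthonormal_columns r V"
  shows "(norm (x - (\<Sum>k<r. (V k \<bullet> x) *\<^sub>R V k)))\<^sup>2 = (norm x)\<^sup>2 - (\<Sum>k<r. (V k \<bullet> x)\<^sup>2)"
proof -
  let ?p = "\<Sum>k<r. (V k \<bullet> x) *\<^sub>R V k"
  have "x \<bullet> ?p = (\<Sum>k<r. (V k \<bullet> x)\<^sup>2)"
    by (simp add: inner_sum_right inner_commute power2_eq_square)
  moreover have "?p \<bullet> ?p = (\<Sum>k<r. (V k \<bullet> x)\<^sup>2)"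
    using norm_orthonormal_sum[OF assms] by (simp add: power2_norm_eq_inner)
  ultimately show ?thesis
    unfolding power2_norm_eq_inner by (simp add: inner_diff inner_commute)
qed

lemma sandwich_eq_sum_outer:
  "sandwich r U A V = (\<Sum>k<r. \<Sum>l<r. A k l *\<^sub>R outer (U k) (V l))"
  by (simp add: sandwich_def outer_def vec_eq_iff mult.commute mult.left_commute)

lemma sandwich_diagonal:
  assumes "\<And>k l. k < r \<Longrightarrow> l < r \<Longrightarrow> k \<noteq> l \<Longrightarrow> A k l = 0"
  shows "sandwich r U A V = (\<Sum>k<r. A k k *\<^sub>R outer (U k) (V k))"
  unfolding sandwich_eq_sum_outer
proof (intro sum.cong refl)
  fix k assume k: "k \<in> {..<r}"
  have "(\<Sum>l<r. A k l *\<^sub>R outer (U k) (V l)) =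
      (\<Sum>l<r. if k = l then A k l *\<^sub>R outer (U k) (V l) else 0)"
    using assms k by (intro sum.cong) auto
  then show "(\<Sum>l<r. A k l *\<^sub>R outer (U k) (V l)) = A k k *\<^sub>R outer (U k) (V k)"
    using k by simp
qed

lemma compact_svdI:
  assumes "orthonormal_columns r U" "orthonormal_columns r V" "\<And>k. k < r \<Longrightarrow> s k > 0"
    and "X = (\<Sum>k<r. s k *\<^sub>R outer (U k) (V k))"
  shows "compact_svd X r U (\<lambda>k l. if k = l then s k else 0) V"
  using assms by (simp add: compact_svd_def sandwich_diagonal)

lemma sum_outer_mult_vec:
  "(\<Sum>k<r. s k *\<^sub>R outer (U k) (V k)) *v x = (\<Sum>k<r. (s k * (V k \<bullet> x)) *\<^sub>R U k)"
  by (simp add: linear_sum[OF linear_matrix_mult_vec] linear_scale[OF linear_matrix_mult_vec] outer_mult_vec)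

lemma transpose_sum_outer:
  "transpose (\<Sum>k<r. s k *\<^sub>R outer (U k) (V k)) = (\<Sum>k<r. s k *\<^sub>R outer (V k) (U k))"
  by (simp add: linear_sum[OF linear_transpose] linear_scale[OF linear_transpose] transpose_outer)

section \<open>Singular value decomposition\<close>

text \<open>The number \<open>r\<close> is not tied to \<open>rank X\<close>, so the results apply
  both to the decompositions in the theorem and to one obtained from
  \<open>ex_compact_svd\<close>.\<close>

locale svd_factors =
  fixes X :: "real^'n^'m" and r U \<Sigma> V
  assumes svd: "compact_svd X r U \<Sigma> V"
begin

lemma orthonormal_U: "orthonormal_columns r U"
  and orthonormal_V: "orthonormal_columns r V"
  and pos: "k < r \<Longrightarrow> \<Sigma> k k > 0"
  using svd by (auto simp: compact_svd_def)

lemma expansion: "X = (\<Sum>k<r. \<Sigma> k k *\<^sub>R outer (U k) (V k))"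
  using svd sandwich_diagonal[of r \<Sigma> U V] by (auto simp: compact_svd_def)

lemma mult_vec: "X *v x = (\<Sum>k<r. (\<Sigma> k k * (V k \<bullet> x)) *\<^sub>R U k)"
  by (subst expansion) (rule sum_outer_mult_vec)

lemma transpose_mult_vec: "transpose X *v x = (\<Sum>k<r. (\<Sigma> k k * (U k \<bullet> x)) *\<^sub>R V k)"
  by (subst expansion) (simp only: transpose_sum_outer sum_outer_mult_vec)

lemma mult_V:
  assumes "k < r"
  shows "X *v V k = \<Sigma> k k *\<^sub>R U k"
proof -
  have "X *v V k = (\<Sum>l<r. if k = l then \<Sigma> l l *\<^sub>R U l else 0)"
    unfolding mult_vec using assms orthonormal_columnsD[OF orthonormal_V]
    by (intro sum.cong) auto
  then show ?thesis using assms by simp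
qed

lemma transpose_mult_U:
  assumes "k < r"
  shows "transpose X *v U k = \<Sigma> k k *\<^sub>R V k"
proof -
  have "transpose X *v U k = (\<Sum>l<r. if k = l then \<Sigma> l l *\<^sub>R V l else 0)"
    unfolding transpose_mult_vec using assms orthonormal_columnsD[OF orthonormal_U]
    by (intro sum.cong) auto
  then show ?thesis using assms by simp
qed

text \<open>Each \<open>V k\<close> is an eigenvector of the Gram matrix for
  \<open>(\<Sigma> k k)\<^sup>2\<close>. Conversely, as \<open>s\<close> is positive, an eigenvector
  lies in the span of all \<open>V k\<close>, and comparing coefficients kills those with another
  singular value.\<close>

lemma gram_eigenspace_eq_span:
  assumes "s > 0"
  shows "gram_eigenspace X (s\<^sup>2) = span (V ` {k. k < r \<and> \<Sigma> k k = s})"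
    (is "?E = span ?B")
proof
  have "subspace ?E"
    by (auto simp: gram_eigenspace_def subspace_def matrix_vector_right_distrib
        matrix_vector_mult_scaleR scaleR_right_distrib)
  moreover have "?B \<subseteq> ?E"
    by (auto simp: gram_eigenspace_def matrix_vector_mul_assoc[symmetric] mult_V
        matrix_vector_mult_scaleR transpose_mult_U power2_eq_square
        simp del: transpose_matrix_vector)
  ultimately show "span ?B \<subseteq> ?E" by (rule span_minimal[rotated])
  show "?E \<subseteq> span ?B"
  proof
    fix x assume "x \<in> ?E"
    then have x: "transpose X *v (X *v x) = s\<^sup>2 *\<^sub>R x"
      by (simp add: gram_eigenspace_def matrix_vector_mul_assoc del: transpose_matrix_vector)
    have U: "U k \<bullet> (X *v x) = \<Sigma> k k * (V k \<bullet> x)" if "k < r" for k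
      using transpose_vec_inner[of X "U k" x] that
      by (simp add: transpose_mult_U del: transpose_matrix_vector)
    have eq: "s\<^sup>2 *\<^sub>R x = (\<Sum>k<r. ((\<Sigma> k k)\<^sup>2 * (V k \<bullet> x)) *\<^sub>R V k)"
      unfolding x[symmetric] transpose_mult_vec[of "X *v x"]
      by (intro sum.cong) (auto simp: U power2_eq_square)
    have zero: "V k \<bullet> x = 0" if "k < r" "\<Sigma> k k \<noteq> s" for k
    proof -
      have "s\<^sup>2 * (V k \<bullet> x) = V k \<bullet> (s\<^sup>2 *\<^sub>R x)" by simp
      also have "\<dots> = (\<Sigma> k k)\<^sup>2 * (V k \<bullet> x)"
        unfolding eq by (rule inner_orthonormal_sum[OF orthonormal_V that(1)])
      finally have "s\<^sup>2 = (\<Sigma> k k)\<^sup>2 \<or> V k \<bullet> x = 0" by auto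
      then show ?thesis
        using that pos[OF that(1)] assms by (auto simp: power2_eq_iff)
    qed
    have "((\<Sigma> k k)\<^sup>2 * (V k \<bullet> x)) *\<^sub>R V k \<in> span ?B" if "k < r" for k
    proof (cases "\<Sigma> k k = s")
      case True
      with that show ?thesis by (intro span_mul span_base) auto
    qed (simp add: zero that span_zero)
    then have "s\<^sup>2 *\<^sub>R x \<in> span ?B"
      unfolding eq by (intro span_sum) auto
    then have "inverse (s\<^sup>2) *\<^sub>R s\<^sup>2 *\<^sub>R x \<in> span ?B" by (rule span_mul)
    then show "x \<in> span ?B" using assms by simp
  qed
qed

lemma inj_on_V: "inj_on V {..<r}"
proof (rule inj_onI)
  fix k l assume "k \<in> {..<r}" "l \<in> {..<r}" "V k = V l"
  then show "k = l"
    using orthonormal_columnsD[OF orthonormal_V, of k l] orthonormal_columnsD[OF orthonormal_V, of k k]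
    by (auto split: if_splits)
qed

lemma dim_gram_eigenspace:
  assumes "s > 0"
  shows "dim (gram_eigenspace X (s\<^sup>2)) = card {k. k < r \<and> \<Sigma> k k = s}"
proof -
  let ?I = "{k. k < r \<and> \<Sigma> k k = s}"
  have "pairwise orthogonal (V ` ?I)"
    using orthonormal_columnsD[OF orthonormal_V] by (auto simp: pairwise_def orthogonal_def)
  moreover have "0 \<notin> V ` ?I"
    using orthonormal_columns_norm[OF orthonormal_V] by force
  ultimately have "independent (V ` ?I)" by (rule pairwise_orthogonal_independent)
  then have "dim (V ` ?I) = card (V ` ?I)" by (rule dim_eq_card_independent)
  also have "\<dots> = card ?I"
    by (intro card_image inj_on_subset[OF inj_on_V]) auto
  finally show ?thesis using gram_eigenspace_eq_span[OF assms] by simp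
qed

lemma pos_singular_values_eq: "pos_singular_values X = (\<lambda>k. \<Sigma> k k) ` {..<r}"
proof (intro set_eqI iffI)
  fix s assume "s \<in> pos_singular_values X"
  then obtain v where s: "s > 0" and v: "v \<noteq> 0" "v \<in> gram_eigenspace X (s\<^sup>2)"
    by (auto simp: pos_singular_values_def)
  then have "v \<in> span (V ` {k. k < r \<and> \<Sigma> k k = s})"
    by (simp add: gram_eigenspace_eq_span)
  with v(1) have "{k. k < r \<and> \<Sigma> k k = s} \<noteq> {}"
    by (intro notI) simp
  then show "s \<in> (\<lambda>k. \<Sigma> k k) ` {..<r}" by auto
next
  fix s assume "s \<in> (\<lambda>k. \<Sigma> k k) ` {..<r}"
  then obtain k where k: "k < r" "s = \<Sigma> k k" by auto
  then have "V k \<in> gram_eigenspace X (s\<^sup>2)" "V k \<noteq> 0" "s > 0"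
    using gram_eigenspace_eq_span[of s] pos orthonormal_columns_norm[OF orthonormal_V, of k]
    by (auto intro: span_base)
  then show "s \<in> pos_singular_values X" by (auto simp: pos_singular_values_def)
qed

text \<open>When the indices are grouped by singular value, the size of each group is the dimension
  of the eigenspace. This links the basis-free definition to any decomposition.\<close>

lemma nuclear_norm_eq: "nuclear_norm X = (\<Sum>k<r. \<Sigma> k k)"
proof -
  have "(\<Sum>k<r. \<Sigma> k k) = (\<Sum>s\<in>pos_singular_values X. \<Sum>k\<in>{k\<in>{..<r}. \<Sigma> k k = s}. \<Sigma> k k)"
    unfolding pos_singular_values_eq by (rule sum.image_gen) simp
  also have "\<dots> = nuclear_norm X"
    unfolding nuclear_norm_def
  proof (intro sum.cong refl)
    fix s assume "s \<in> pos_singular_values X"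
    then have "s > 0" by (simp add: pos_singular_values_def)
    then show "(\<Sum>k\<in>{k\<in>{..<r}. \<Sigma> k k = s}. \<Sigma> k k) = s * real (dim (gram_eigenspace X (s\<^sup>2)))"
      by (simp add: dim_gram_eigenspace)
  qed
  finally show ?thesis ..
qed

end

text \<open>A maximiser of \<open>norm (X *v v)\<close> on the compact unit sphere works, since its
  first-order condition is the eigenvector equation.\<close>

lemma ex_leading_right_singular_vector:
  fixes X :: "real^'n^'m"
  assumes "X \<noteq> 0"
  obtains v \<sigma> where "norm v = 1" "\<sigma> > 0" "norm (X *v v) = \<sigma>"
    "transpose X *v (X *v v) = \<sigma>\<^sup>2 *\<^sub>R v"
proof -
  have "continuous_on (sphere 0 1) (\<lambda>v. norm (X *v v))"
    by (intro continuous_on_norm linear_continuous_on linear_linear[THEN iffD2] matrix_vector_mul_linear)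
  moreover have "sphere (0::real^'n) 1 \<noteq> {}" by simp
  ultimately obtain v where v: "norm v = 1" and
      max: "\<And>w. norm w = 1 \<Longrightarrow> norm (X *v w) \<le> norm (X *v v)"
    using continuous_attains_sup[of "sphere 0 1" "\<lambda>v. norm (X *v v)"] by auto
  define \<sigma> where "\<sigma> = norm (X *v v)"
  have le: "norm (X *v w) \<le> \<sigma> * norm w" for w
  proof (cases "w = 0")
    case False
    then have "norm (X *v ((1 / norm w) *\<^sub>R w)) \<le> \<sigma>"
      unfolding \<sigma>_def by (intro max) simp
    with False show ?thesis
      by (simp add: matrix_vector_mult_scaleR field_simps)
  qed simp
  have "\<sigma> > 0"
  proof (rule ccontr)
    assume "\<not> \<sigma> > 0"
    then have "X *v w = 0" for w
      using le[of w] by (simp add: \<sigma>_def)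
    then have "X = 0" by (simp add: matrix_eq)
    with assms show False by simp
  qed
  define g where "g = transpose X *v (X *v v) - \<sigma>\<^sup>2 *\<^sub>R v"
  \<comment> \<open>With this step size the quadratic term
    \<open>t\<^sup>2 * \<sigma>\<^sup>2 * (g \<bullet> g)\<close> is only half of the linear gain
    \<open>2 * t * (g \<bullet> g)\<close>, which forces \<open>g = 0\<close>.\<close>
  define t where "t = 1 / \<sigma>\<^sup>2"
  have gg: "(X *v v) \<bullet> (X *v g) - \<sigma>\<^sup>2 * (v \<bullet> g) = g \<bullet> g"
    unfolding transpose_vec_inner[symmetric] by (simp add: g_def inner_diff_left)
  \<comment> \<open>\<open>g\<close> is half the gradient of \<open>\<lambda>v. \<parallel>X v\<parallel>\<^sup>2 - \<sigma>\<^sup>2 \<parallel>v\<parallel>\<^sup>2\<close>, which is maximal at \<open>v\<close>.\<close>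
  have "(norm (X *v (v + t *\<^sub>R g)))\<^sup>2 \<le> (\<sigma> * norm (v + t *\<^sub>R g))\<^sup>2"
    using le by (rule power_mono) simp
  moreover have "(norm (X *v (v + t *\<^sub>R g)))\<^sup>2 =
      \<sigma>\<^sup>2 + 2 * t * ((X *v v) \<bullet> (X *v g)) + t\<^sup>2 * (norm (X *v g))\<^sup>2"
    by (simp add: matrix_vector_right_distrib matrix_vector_mult_scaleR power2_norm_eq_inner
        \<sigma>_def inner_add inner_commute algebra_simps power2_eq_square[of t])
  moreover have "(norm (v + t *\<^sub>R g))\<^sup>2 = 1 + 2 * t * (v \<bullet> g) + t\<^sup>2 * (g \<bullet> g)"
    using v by (simp add: power2_norm_eq_inner norm_eq_1 inner_add inner_commute algebra_simps
        power2_eq_square[of t])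
  ultimately have "2 * t * ((X *v v) \<bullet> (X *v g) - \<sigma>\<^sup>2 * (v \<bullet> g)) + t\<^sup>2 * (norm (X *v g))\<^sup>2
      \<le> t\<^sup>2 * \<sigma>\<^sup>2 * (g \<bullet> g)"
    by (simp add: power_mult_distrib algebra_simps)
  then have "2 * t * (g \<bullet> g) \<le> t\<^sup>2 * \<sigma>\<^sup>2 * (g \<bullet> g)"
    unfolding gg by (smt (verit) zero_le_power2 mult_nonneg_nonneg)
  also have "\<dots> = t * (g \<bullet> g)"
    using \<open>\<sigma> > 0\<close> by (simp add: t_def power2_eq_square)
  finally have "t * (g \<bullet> g) \<le> 0" by simp
  moreover have "t > 0" using \<open>\<sigma> > 0\<close> by (simp add: t_def)
  ultimately have "g \<bullet> g \<le> 0" by (simp add: mult_le_0_iff)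
  then have "g = 0" by (metis antisym inner_eq_zero_iff inner_ge_zero)
  then have "transpose X *v (X *v v) = \<sigma>\<^sup>2 *\<^sub>R v"
    by (simp only: g_def right_minus_eq)
  with v \<open>\<sigma> > 0\<close> show thesis
    by (intro that[of v \<sigma>]) (simp_all only: \<sigma>_def)
qed

lemma orthonormal_columns_extend:
  assumes "orthonormal_columns r U" "norm u = 1" "\<And>k. k < r \<Longrightarrow> U k \<bullet> u = 0"
  shows "orthonormal_columns (Suc r) (U(r := u))"
  using assms by (auto simp: orthonormal_columns_def less_Suc_eq norm_eq_1 inner_commute)

text \<open>Splitting off the leading singular triple enlarges the kernel.\<close>

lemma ex_compact_svd:
  fixes X :: "real^'n^'m"
  shows "\<exists>r U \<Sigma> V. compact_svd X r U \<Sigma> V"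
proof (induction "CARD('n) - dim {w. X *v w = 0}" arbitrary: X rule: less_induct)
  case less
  show ?case
  proof (cases "X = 0")
    case True
    \<comment> \<open>The empty decomposition, with arbitrary \<open>U\<close>, \<open>s\<close> and
      \<open>V\<close>.\<close>
    then have "compact_svd X 0 U (\<lambda>k l. if k = l then s k else 0) V" for U s V
      by (intro compact_svdI) (auto simp: orthonormal_columns_def)
    then show ?thesis by blast
  next
    case False
    then obtain v \<sigma> where v: "norm v = 1" "\<sigma> > 0" "norm (X *v v) = \<sigma>"
        and vv: "transpose X *v (X *v v) = \<sigma>\<^sup>2 *\<^sub>R v"
      by (rule ex_leading_right_singular_vector)
    define u where "u = (1 / \<sigma>) *\<^sub>R (X *v v)"
    have u: "norm u = 1" "X *v v = \<sigma> *\<^sub>R u"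
      using v by (simp_all add: u_def)
    have Xu: "transpose X *v u = \<sigma> *\<^sub>R v"
      using v(2) vv by (simp add: u_def matrix_vector_mult_scaleR power2_eq_square
          del: transpose_matrix_vector)
    define Y where "Y = X - \<sigma> *\<^sub>R outer u v"
    have Y: "Y *v w = X *v w - (\<sigma> * (v \<bullet> w)) *\<^sub>R u" for w
      by (simp add: Y_def matrix_vector_mult_diff_rdistrib linear_scale[OF linear_matrix_mult_vec]
          outer_mult_vec)
    have Yv: "Y *v v = 0"
      using v(1) u(2) by (simp add: Y norm_eq_1)
    have Yu: "transpose Y *v u = 0"
      using u(1) Xu by (simp add: Y_def linear_diff[OF linear_transpose] linear_scale[OF linear_transpose]
          transpose_outer matrix_vector_mult_diff_rdistrib linear_scale[OF linear_matrix_mult_vec]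
          outer_mult_vec norm_eq_1 del: transpose_matrix_vector)
    have sub: "subspace {w. A *v w = 0}" for A :: "real^'n^'m"
      by (auto simp: subspace_def matrix_vector_right_distrib matrix_vector_mult_scaleR)
    \<comment> \<open>Kernel vectors of \<open>X\<close> are orthogonal to \<open>v\<close>, a
      multiple of \<open>transpose X *v u\<close>, so \<open>Y\<close> kills them too;
      \<open>v\<close> itself is new.\<close>
    have "{w. X *v w = 0} \<subset> {w. Y *v w = 0}"
    proof
      show "{w. X *v w = 0} \<subseteq> {w. Y *v w = 0}"
      proof clarify
        fix w assume w: "X *v w = 0"
        have "\<sigma> * (v \<bullet> w) = (transpose X *v u) \<bullet> w" by (simp only: Xu inner_scaleR_left)
        also have "\<dots> = 0" by (simp only: transpose_vec_inner w inner_zero_right)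
        finally show "Y *v w = 0" by (simp add: Y w)
      qed
      have "X *v v \<noteq> 0" using v by auto
      with Yv show "{w. X *v w = 0} \<noteq> {w. Y *v w = 0}" by blast
    qed
    then have "dim {w. X *v w = 0} < dim {w. Y *v w = 0}"
      by (intro dim_psubset) (simp add: span_eq_iff[THEN iffD2, OF sub])
    moreover have "dim {w. Y *v w = 0} \<le> CARD('n)"
      using dim_subset_UNIV[of "{w. Y *v w = 0}"] by simp
    ultimately have "CARD('n) - dim {w. Y *v w = 0} < CARD('n) - dim {w. X *v w = 0}"
      by simp
    then obtain r U \<Sigma> V where "compact_svd Y r U \<Sigma> V"
      using less by blast
    then interpret svd_factors Y r U \<Sigma> V by unfold_locales
    \<comment> \<open>Old and new vectors are orthogonal: \<open>Y\<close> annihilates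
      \<open>v\<close> and \<open>transpose Y\<close> annihilates \<open>u\<close>, while the
      \<open>V k\<close> and \<open>U k\<close> lie in the ranges of \<open>transpose Y\<close> and
      \<open>Y\<close>.\<close>
    have "V k \<bullet> v = 0" if "k < r" for k
    proof -
      have "\<Sigma> k k * (V k \<bullet> v) = (transpose Y *v U k) \<bullet> v"
        by (simp only: transpose_mult_U[OF that] inner_scaleR_left)
      also have "\<dots> = 0" by (simp only: transpose_vec_inner Yv inner_zero_right)
      finally show ?thesis using pos[OF that] by simp
    qed
    moreover have "U k \<bullet> u = 0" if "k < r" for k
    proof -
      have "\<Sigma> k k * (U k \<bullet> u) = u \<bullet> (Y *v V k)"
        by (simp add: mult_V[OF that] inner_commute)
      also have "\<dots> = 0" by (simp only: transpose_vec_inner[symmetric] Yu inner_zero_left)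
      finally show ?thesis using pos[OF that] by simp
    qed
    ultimately have "compact_svd X (Suc r) (U(r := u))
        (\<lambda>k l. if k = l then ((\<lambda>k. \<Sigma> k k)(r := \<sigma>)) k else 0) (V(r := v))"
      using u(1) v(1,2) expansion
      by (intro compact_svdI orthonormal_columns_extend orthonormal_U orthonormal_V)
        (auto simp: less_Suc_eq pos Y_def algebra_simps)
    then show ?thesis by blast
  qed
qed

section \<open>Duality with the operator norm\<close>

definition contraction :: "real^'n^'m \<Rightarrow> bool" where
  "contraction S \<longleftrightarrow> (\<forall>v. norm (S *v v) \<le> norm v)"

lemma contraction_inner_le:
  assumes "contraction S" "norm u \<le> 1" "norm v \<le> 1"
  shows "(S *v v) \<bullet> u \<le> 1"
proof -
  have "(S *v v) \<bullet> u \<le> norm (S *v v) * norm u" by (rule norm_cauchy_schwarz)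
  also have "\<dots> \<le> 1 * 1"
    using assms by (intro mult_mono) (auto simp: contraction_def intro: order_trans)
  finally show ?thesis by simp
qed

lemma contraction_if_norm_le_1: "norm S \<le> 1 \<Longrightarrow> contraction S"
  unfolding contraction_def
  by (metis norm_matrix_vec_le mult_left_le_one_le norm_ge_zero order_trans)

section \<open>Trace duality, its equality case and the polar factor\<close>

context svd_factors
begin

lemma inner_expansion: "S \<bullet> X = (\<Sum>k<r. \<Sigma> k k * ((S *v V k) \<bullet> U k))"
  by (subst expansion) (simp add: inner_sum_right inner_outer)

lemma inner_le_nuclear_norm:
  assumes "contraction S"
  shows "S \<bullet> X \<le> nuclear_norm X"
  unfolding nuclear_norm_eq inner_expansion
proof (intro sum_mono)
  fix k assume "k \<in> {..<r}"
  then show "\<Sigma> k k * ((S *v V k) \<bullet> U k) \<le> \<Sigma> k k"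
    using contraction_inner_le[OF assms, of "U k" "V k"] pos[of k]
      orthonormal_columns_norm[OF orthonormal_U] orthonormal_columns_norm[OF orthonormal_V]
    by (intro mult_right_le_one_le[THEN order_trans] mult_left_le) auto
qed

text \<open>As the weights are positive, equality forces every term of the weighted sum to be
  maximal; equality in Cauchy-Schwarz then determines the images.\<close>

lemma inner_eq_nuclear_normD:
  assumes "contraction S" "S \<bullet> X = nuclear_norm X" "k < r"
  shows "S *v V k = U k" "transpose S *v U k = V k"
proof -
  have U: "norm (U l) = 1" and V: "norm (V l) = 1" if "l < r" for l
    using that orthonormal_columns_norm[OF orthonormal_U] orthonormal_columns_norm[OF orthonormal_V]
    by auto
  have le: "(S *v V l) \<bullet> U l \<le> 1" if "l < r" for l
    using contraction_inner_le[OF assms(1)] U V that by simp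
  have "(\<Sum>l<r. \<Sigma> l l * (1 - (S *v V l) \<bullet> U l)) = 0"
    using assms(2) unfolding nuclear_norm_eq inner_expansion
    by (simp add: right_diff_distrib sum_subtractf)
  then have "\<forall>l\<in>{..<r}. \<Sigma> l l * (1 - (S *v V l) \<bullet> U l) = 0"
    using le pos by (subst (asm) sum_nonneg_eq_0_iff) (auto simp: less_imp_le)
  then have 1: "(S *v V k) \<bullet> U k = 1"
    using assms(3) pos[OF assms(3)] by force
  have "norm (S *v V k) \<le> 1"
    using assms(1) V[OF assms(3)] unfolding contraction_def by metis
  then have "(S *v V k) \<bullet> (S *v V k) \<le> 1"
    by (simp add: norm_le_square)
  \<comment> \<open>The square expands to at most \<open>1 - 2 + 1\<close>.\<close>
  then have "(norm (S *v V k - U k))\<^sup>2 \<le> 0"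
    using 1 U[OF assms(3)] unfolding power2_norm_eq_inner
    by (simp add: inner_diff inner_commute norm_eq_1)
  then show 2: "S *v V k = U k" by simp
  \<comment> \<open>The contraction bound passes to the transpose at this vector, via
    \<open>(norm ?w)\<^sup>2 \<le> norm ?w\<close>.\<close>
  let ?w = "transpose S *v U k"
  have "(norm ?w)\<^sup>2 = U k \<bullet> (S *v ?w)"
    unfolding power2_norm_eq_inner by (rule transpose_vec_inner)
  also have "\<dots> \<le> norm (U k) * norm (S *v ?w)" by (rule norm_cauchy_schwarz)
  also have "\<dots> \<le> norm ?w"
    using assms(1) U[OF assms(3)] by (simp add: contraction_def del: transpose_matrix_vector)
  finally have "norm ?w \<le> 1"
    by (cases "?w = 0") (auto simp: power2_eq_square simp del: transpose_matrix_vector)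
  then have "?w \<bullet> ?w \<le> 1"
    by (simp add: norm_le_square del: transpose_matrix_vector)
  moreover have "?w \<bullet> V k = 1"
    unfolding transpose_vec_inner 2 using U[OF assms(3)] by (simp add: norm_eq_1)
  ultimately have "(norm (?w - V k))\<^sup>2 \<le> 0"
    using V[OF assms(3)] unfolding power2_norm_eq_inner
    by (simp add: inner_diff inner_commute norm_eq_1 del: transpose_matrix_vector)
  then show "?w = V k" by simp
qed

text \<open>This is \<open>U V\<^sup>T\<close>, the partial isometry in the polar decomposition of
  \<open>X\<close>.\<close>

definition polar_factor where "polar_factor = (\<Sum>k<r. outer (U k) (V k))"

lemma polar_factor_mult_vec: "polar_factor *v x = (\<Sum>k<r. (V k \<bullet> x) *\<^sub>R U k)"
  by (simp add: polar_factor_def linear_sum[OF linear_matrix_mult_vec] outer_mult_vec)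

lemma transpose_polar_factor_mult_vec:
  "transpose polar_factor *v x = (\<Sum>k<r. (U k \<bullet> x) *\<^sub>R V k)"
  by (simp add: polar_factor_def linear_sum[OF linear_transpose] transpose_outer
      linear_sum[OF linear_matrix_mult_vec] outer_mult_vec del: transpose_matrix_vector)

lemma polar_factor_mult_V:
  assumes "k < r"
  shows "polar_factor *v V k = U k"
proof -
  have "polar_factor *v V k = (\<Sum>l<r. if k = l then U l else 0)"
    unfolding polar_factor_mult_vec using assms orthonormal_columnsD[OF orthonormal_V]
    by (intro sum.cong) auto
  then show ?thesis using assms by simp
qed

lemma transpose_polar_factor_mult_U:
  assumes "k < r"
  shows "transpose polar_factor *v U k = V k"
proof -
  have "transpose polar_factor *v U k = (\<Sum>l<r. if k = l then V l else 0)"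
    unfolding transpose_polar_factor_mult_vec using assms orthonormal_columnsD[OF orthonormal_U]
    by (intro sum.cong) auto
  then show ?thesis using assms by simp
qed

text \<open>\<open>W\<close> sees only the part \<open>z\<close> of \<open>x\<close> orthogonal to
  the \<open>V k\<close>, and its range is orthogonal to the \<open>U k\<close>. So the two images
  add by Pythagoras, and the Bessel identity bounds the result.\<close>

lemma contraction_polar_factor_add:
  assumes "contraction W" "\<And>k. k < r \<Longrightarrow> W *v V k = 0" "\<And>k. k < r \<Longrightarrow> transpose W *v U k = 0"
  shows "contraction (polar_factor + W)"
  unfolding contraction_def
proof
  fix x
  define z where "z = x - (\<Sum>k<r. (V k \<bullet> x) *\<^sub>R V k)"
  let ?p = "polar_factor *v x"
  have z: "(norm z)\<^sup>2 = (norm x)\<^sup>2 - (\<Sum>k<r. (V k \<bullet> x)\<^sup>2)"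
    unfolding z_def by (rule bessel_residual[OF orthonormal_V])
  have "W *v (\<Sum>k<r. (V k \<bullet> x) *\<^sub>R V k) = 0"
    by (simp add: linear_sum[OF matrix_vector_mul_linear] matrix_vector_mult_scaleR assms(2))
  then have W: "W *v x = W *v z"
    by (simp add: z_def matrix_vector_mult_diff_distrib)
  have "U k \<bullet> (W *v x) = 0" if "k < r" for k
    using transpose_vec_inner[of W "U k" x] assms(3)[OF that]
    by (simp del: transpose_matrix_vector)
  then have "orthogonal ?p (W *v x)"
    by (simp add: orthogonal_def polar_factor_mult_vec inner_sum_left)
  then have "(norm (?p + W *v x))\<^sup>2 = (norm ?p)\<^sup>2 + (norm (W *v x))\<^sup>2"
    by (rule norm_add_Pythagorean)
  also have "(norm ?p)\<^sup>2 = (\<Sum>k<r. (V k \<bullet> x)\<^sup>2)"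
    unfolding polar_factor_mult_vec by (rule norm_orthonormal_sum[OF orthonormal_U])
  also have "(norm (W *v x))\<^sup>2 \<le> (norm z)\<^sup>2"
    unfolding W using assms(1) by (intro power_mono) (auto simp: contraction_def)
  finally have "(norm ((polar_factor + W) *v x))\<^sup>2 \<le> (norm x)\<^sup>2"
    by (simp add: z matrix_vector_mult_add_rdistrib)
  then show "norm ((polar_factor + W) *v x) \<le> norm x" by simp
qed

lemma contraction_polar_factor: "contraction polar_factor"
  using contraction_polar_factor_add[of 0]
  by (simp add: contraction_def linear_0[OF linear_transpose])

lemma inner_eq_nuclear_norm:
  assumes "\<And>k. k < r \<Longrightarrow> S *v V k = U k"
  shows "S \<bullet> X = nuclear_norm X"
  unfolding nuclear_norm_eq inner_expansion using assms orthonormal_columns_norm[OF orthonormal_U]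
  by (intro sum.cong) (auto simp: norm_eq_1)

end

lemma contraction_inner_le_nuclear_norm:
  assumes "contraction S"
  shows "S \<bullet> X \<le> nuclear_norm X"
  using ex_compact_svd[of X] svd_factors.inner_le_nuclear_norm[OF _ assms]
  by (auto simp: svd_factors_def)

text \<open>The polar factor attains the preceding bound, so the nuclear norm is the maximum of
  \<open>S \<bullet> X\<close> over all contractions \<open>S\<close>.\<close>

lemma ex_contraction_inner_eq_nuclear_norm:
  obtains S where "contraction S" "S \<bullet> X = nuclear_norm X"
proof -
  obtain r U \<Sigma> V where "compact_svd X r U \<Sigma> V" using ex_compact_svd by blast
  then interpret svd_factors X r U \<Sigma> V by unfold_locales
  show thesis
    using that contraction_polar_factor inner_eq_nuclear_norm polar_factor_mult_V by blast
qed

text \<open>A maximum of linear functionals is subadditive: the maximiser for the sum competes for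
  both summands.\<close>

lemma nuclear_norm_triangle: "nuclear_norm (X + Y) \<le> nuclear_norm X + nuclear_norm Y"
proof -
  obtain S where S: "contraction S" "S \<bullet> (X + Y) = nuclear_norm (X + Y)"
    by (rule ex_contraction_inner_eq_nuclear_norm)
  then show ?thesis
    using contraction_inner_le_nuclear_norm[OF S(1), of X]
      contraction_inner_le_nuclear_norm[OF S(1), of Y] by (simp add: inner_add_right)
qed

lemma nuclear_norm_0 [simp]: "nuclear_norm 0 = 0"
  by (metis ex_contraction_inner_eq_nuclear_norm inner_zero_right)

lemma nuclear_norm_nonneg: "nuclear_norm X \<ge> 0"
  by (auto simp: nuclear_norm_def pos_singular_values_def intro!: sum_nonneg)

text \<open>Normalising both nonzero factors gives a decomposition with a single singular
  value.\<close>

lemma nuclear_norm_outer: "nuclear_norm (outer u v) = norm u * norm v"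
proof (cases "u = 0 \<or> v = 0")
  case True
  then have "outer u v = 0" by (auto simp: outer_def vec_eq_iff)
  with True show ?thesis by auto
next
  case False
  define s where "s = norm u * norm v"
  have "compact_svd (outer u v) 1 (\<lambda>_. (1 / norm u) *\<^sub>R u)
      (\<lambda>k l. if k = l then s else 0) (\<lambda>_. (1 / norm v) *\<^sub>R v)"
    using False
    by (intro compact_svdI) (auto simp: s_def orthonormal_columns_def outer_def vec_eq_iff dot_square_norm power2_eq_square)
  then interpret svd_factors "outer u v" 1 "\<lambda>_. (1 / norm u) *\<^sub>R u"
      "\<lambda>k l. if k = l then s else 0" "\<lambda>_. (1 / norm v) *\<^sub>R v"
    by unfold_locales
  show ?thesis using nuclear_norm_eq by (simp add: s_def)
qed

text \<open>A rank-one step \<open>outer (S *v v) v\<close> in the subgradient inequality shows that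
  \<open>S\<close> is a contraction, and the point \<open>0\<close> gives
  \<open>S \<bullet> X\<close> its lower bound. The converse is trace duality.\<close>

lemma subdifferential_nuclear_norm:
  "subdifferential nuclear_norm X = {S. contraction S \<and> S \<bullet> X = nuclear_norm X}"
proof (intro set_eqI iffI; clarsimp)
  fix S assume "S \<in> subdifferential nuclear_norm X"
  then have S: "nuclear_norm Y \<ge> nuclear_norm X + S \<bullet> (Y - X)" for Y
    by (simp add: subdifferential_def)
  have "contraction S"
    unfolding contraction_def
  proof
    fix v
    have "(norm (S *v v))\<^sup>2 = S \<bullet> outer (S *v v) v"
      by (simp add: inner_outer power2_norm_eq_inner)
    also have "\<dots> \<le> norm (S *v v) * norm v"
      using S[of "X + outer (S *v v) v"] nuclear_norm_triangle[of X "outer (S *v v) v"]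
      by (simp add: nuclear_norm_outer)
    finally show "norm (S *v v) \<le> norm v"
      by (cases "S *v v = 0") (auto simp: power2_eq_square)
  qed
  moreover have "nuclear_norm X \<le> S \<bullet> X"
    using S[of 0] by simp
  ultimately show "contraction S \<and> S \<bullet> X = nuclear_norm X"
    using contraction_inner_le_nuclear_norm by (auto intro: antisym)
next
  fix S assume "contraction S" "S \<bullet> X = nuclear_norm X"
  then show "S \<in> subdifferential nuclear_norm X"
    by (auto simp: subdifferential_def inner_diff_right intro: contraction_inner_le_nuclear_norm)
qed

section \<open>Relative interior of the subdifferential\<close>

context svd_factors
begin

lemma polar_factor_in_rel_interior:
  "polar_factor \<in> rel_interior (subdifferential nuclear_norm X)"
proof -
  let ?D = "subdifferential nuclear_norm X"
  \<comment> \<open>An affine set that contains the subdifferential, by the equality case, and hence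
    its affine hull.\<close>
  let ?A = "{S. \<forall>k<r. S *v V k = U k \<and> transpose S *v U k = V k}"
  have "?D \<subseteq> ?A"
    by (simp add: subdifferential_nuclear_norm subset_iff inner_eq_nuclear_normD
        del: transpose_matrix_vector)
  moreover have "affine ?A"
    by (simp add: affine_def linear_add[OF linear_matrix_mult_vec] linear_scale[OF linear_matrix_mult_vec]
        linear_add[OF linear_transpose] linear_scale[OF linear_transpose]
        scaleR_left_distrib[symmetric] del: transpose_matrix_vector)
  ultimately have hull: "affine hull ?D \<subseteq> ?A" by (rule hull_minimal)
  \<comment> \<open>In this ball \<open>S - polar_factor\<close> has norm below 1 and kills the
    \<open>V k\<close>, its transpose the \<open>U k\<close>, so
    \<open>contraction_polar_factor_add\<close> applies.\<close>
  have "ball polar_factor 1 \<inter> affine hull ?D \<subseteq> ?D"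
  proof
    fix S assume S: "S \<in> ball polar_factor 1 \<inter> affine hull ?D"
    with hull have SA: "S *v V k = U k" "transpose S *v U k = V k" if "k < r" for k
      using that by auto
    have "contraction (polar_factor + (S - polar_factor))"
    proof (rule contraction_polar_factor_add)
      show "contraction (S - polar_factor)"
        using S by (intro contraction_if_norm_le_1) (simp add: dist_norm norm_minus_commute)
    qed (simp_all add: matrix_vector_mult_diff_rdistrib linear_diff[OF linear_transpose] SA
        polar_factor_mult_V transpose_polar_factor_mult_U del: transpose_matrix_vector)
    then show "S \<in> ?D"
      unfolding subdifferential_nuclear_norm by (simp add: inner_eq_nuclear_norm SA)
  qed
  moreover have "polar_factor \<in> ?D"
    unfolding subdifferential_nuclear_norm
    by (simp add: contraction_polar_factor inner_eq_nuclear_norm polar_factor_mult_V)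
  ultimately show ?thesis
    unfolding mem_rel_interior_ball using zero_less_one by blast
qed

end

section \<open>Quadratic growth\<close>

context svd_factors
begin

text \<open>\<open>U k\<close> is a multiple of \<open>X *v V k\<close>, so it lies in the range of
  \<open>X\<close>, which \<open>P\<close> fixes pointwise.\<close>

lemma left_identity_U:
  assumes "P ** X = X" "k < r"
  shows "P *v U k = U k"
proof -
  have "\<Sigma> k k *\<^sub>R (P *v U k) = (P ** X) *v V k"
    by (simp add: matrix_vector_mul_assoc[symmetric] mult_V assms(2) matrix_vector_mult_scaleR)
  also have "\<dots> = \<Sigma> k k *\<^sub>R U k"
    by (simp add: assms mult_V)
  finally show ?thesis using pos[OF assms(2)] by simp
qed

lemma left_identity_sandwich:
  assumes "P ** X = X"
  shows "P ** sandwich r U A W = sandwich r U A W"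
  unfolding sandwich_eq_sum_outer linear_sum[OF linear_matrix_mult] linear_scale[OF linear_matrix_mult]
    matrix_mult_outer
  by (intro sum.cong refl) (simp add: left_identity_U[OF assms])

lemma left_identity_polar_factor:
  assumes "P ** X = X"
  shows "P ** polar_factor = polar_factor"
  unfolding polar_factor_def linear_sum[OF linear_matrix_mult] matrix_mult_outer
  by (intro sum.cong refl) (simp add: left_identity_U[OF assms])

text \<open>
  With \<open>E\<close> the polar factor and \<open>N\<close> the nuclear norm of \<open>X\<close>, the matrix
  \<open>(N E + H) / sqrt (N\<^sup>2 + \<parallel>H\<parallel>\<^sup>2)\<close> is a contraction, since \<open>E\<close> and \<open>H\<close> have orthogonal ranges;
  its inner product with \<open>X + H\<close> is the lower bound.
\<close>

lemma nuclear_norm_add_ge: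
  assumes "transpose X ** H = 0"
  shows "nuclear_norm (X + H) \<ge> sqrt ((nuclear_norm X)\<^sup>2 + (norm H)\<^sup>2)"
proof (cases "(nuclear_norm X)\<^sup>2 + (norm H)\<^sup>2 = 0")
  \<comment> \<open>Here the normalising factor \<open>m\<close> would be 0, and the bound is mere
    nonnegativity.\<close>
  case True
  then show ?thesis using nuclear_norm_nonneg by simp
next
  case False
  define N where "N = nuclear_norm X"
  define m where "m = sqrt (N\<^sup>2 + (norm H)\<^sup>2)"
  have m: "m > 0" "m\<^sup>2 = N\<^sup>2 + (norm H)\<^sup>2"
    using False by (auto simp: m_def N_def sum_power2_gt_zero_iff)
  let ?E = polar_factor
  \<comment> \<open>The hypothesis makes the range of \<open>H\<close> orthogonal to that of
    \<open>X\<close>, which contains every \<open>U k\<close>.\<close>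
  have UH: "U k \<bullet> (H *v x) = 0" if "k < r" for k x
  proof -
    have "\<Sigma> k k * (U k \<bullet> (H *v x)) = (X *v V k) \<bullet> (H *v x)"
      by (simp add: mult_V[OF that])
    also have "\<dots> = V k \<bullet> ((transpose X ** H) *v x)"
      unfolding matrix_vector_mul_assoc[symmetric]
      by (simp only: transpose_vec_inner[of "transpose X", symmetric] transpose_transpose)
    finally show ?thesis using pos[OF that] assms by simp
  qed
  define S where "S = (1 / m) *\<^sub>R (N *\<^sub>R ?E + H)"
  have Sx: "S *v x = (1 / m) *\<^sub>R (N *\<^sub>R (?E *v x) + H *v x)" for x
    by (simp add: S_def linear_scale[OF linear_matrix_mult_vec] linear_add[OF linear_matrix_mult_vec])
  have "contraction S"
    unfolding contraction_def
  proof
    fix x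
    have "orthogonal (N *\<^sub>R (?E *v x)) (H *v x)"
      by (simp add: orthogonal_def polar_factor_mult_vec inner_sum_left UH)
    then have "(norm (N *\<^sub>R (?E *v x) + H *v x))\<^sup>2 = N\<^sup>2 * (norm (?E *v x))\<^sup>2 + (norm (H *v x))\<^sup>2"
      by (simp add: norm_add_Pythagorean power_mult_distrib)
    also have "\<dots> \<le> N\<^sup>2 * (norm x)\<^sup>2 + (norm H * norm x)\<^sup>2"
      using contraction_polar_factor
      by (intro add_mono mult_left_mono power_mono norm_matrix_vec_le) (auto simp: contraction_def)
    also have "\<dots> = (m * norm x)\<^sup>2"
      by (simp add: power_mult_distrib m algebra_simps)
    finally have "norm (N *\<^sub>R (?E *v x) + H *v x) \<le> m * norm x"
      by (rule power2_le_imp_le) (simp add: m less_imp_le)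
    then show "norm (S *v x) \<le> norm x"
      unfolding Sx norm_scaleR using m(1) by (simp add: field_simps)
  qed
  \<comment> \<open>The cross terms vanish, so that only
    \<open>N * N + H \<bullet> H = m\<^sup>2\<close> survives in \<open>S \<bullet> (X + H)\<close>,
    up to the factor \<open>1 / m\<close>.\<close>
  have HX: "H \<bullet> X = 0"
    by (simp add: inner_expansion inner_commute[of "H *v _"] UH)
  have EH: "?E \<bullet> H = 0"
    by (subst inner_commute)
      (simp add: polar_factor_def inner_sum_right inner_outer inner_commute[of "H *v _"] UH)
  have EX: "?E \<bullet> X = N"
    unfolding N_def by (rule inner_eq_nuclear_norm) (rule polar_factor_mult_V)
  have "S \<bullet> (X + H) = (1 / m) * (N * (?E \<bullet> X) + N * (?E \<bullet> H) + H \<bullet> X + H \<bullet> H)"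
    unfolding S_def inner_scaleR_left inner_add_left inner_add_right
    by (simp add: algebra_simps)
  also have "\<dots> = (1 / m) * m\<^sup>2"
    unfolding m power2_norm_eq_inner HX EH EX by (simp add: power2_eq_square)
  also have "\<dots> = m"
    using m(1) by (simp add: power2_eq_square)
  finally have "S \<bullet> (X + H) = m" .
  then show ?thesis
    using contraction_inner_le_nuclear_norm[OF \<open>contraction S\<close>, of "X + H"] by (simp add: m_def N_def)
qed

end

section \<open>Both regularity conditions, strong minimality and uniqueness\<close>

theorem corollary5p12:
  fixes L :: "real^'n1^'q" and M0 :: "real^'n2^'q"
    and \<Phi> :: "real^'n2^'n1 \<Rightarrow> real^'n2^'q"
    and X0 :: "real^'n2^'n1"
  assumes "CARD('n1) \<le> CARD('n2)"
    and "\<Phi> = (\<lambda>X. L ** X)"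
    and "\<exists>X. \<Phi> X = M0"
    and "X0 = pinv L ** M0"
  shows "(\<forall>U0 \<Sigma>0 V0. compact_svd X0 (rank X0) U0 \<Sigma>0 V0 \<longrightarrow>
            {X. \<Phi> X = 0} \<inter> sym_sandwiches (rank X0) U0 V0 = {0}) \<and>
         range (adjoint \<Phi>) \<inter> rel_interior (subdifferential nuclear_norm X0) \<noteq> {} \<and>
         strong_solution nuclear_norm {X. \<Phi> X = M0} X0 \<and>
         (\<forall>X. strong_solution nuclear_norm {X. \<Phi> X = M0} X \<longrightarrow> X = X0)"
proof (intro conjI allI impI)
  define P where "P = pinv L ** L"
  have LP: "L ** P = L" and PL: "P ** pinv L = pinv L" and P_sym: "transpose P = P"
    using is_pinv_pinv[of L] by (simp_all add: is_pinv_def P_def matrix_mul_assoc)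
  have PX0: "P ** X0 = X0"
    by (simp add: assms(4) matrix_mul_assoc PL)
  \<comment> \<open>Consistency enters here: a right-hand side of the form \<open>L ** X\<close> is
    fixed by \<open>L ** pinv L\<close>.\<close>
  have LX0: "L ** X0 = M0"
    using assms(2,3) is_pinv_pinv[of L] by (auto simp: assms(4) is_pinv_def matrix_mul_assoc)
  \<comment> \<open>\<open>X0\<close> absorbs \<open>P\<close> on the left, and the symmetric
    \<open>P\<close> annihilates \<open>H\<close> because \<open>L\<close> does.\<close>
  have orth: "transpose X0 ** H = 0" if "L ** H = 0" for H :: "real^'n2^'n1"
  proof -
    have "transpose X0 ** H = transpose X0 ** (transpose P ** H)"
      using arg_cong[OF PX0, of transpose] by (simp add: matrix_transpose_mul matrix_mul_assoc)
    also have "transpose P ** H = 0"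
      unfolding P_sym by (simp add: P_def matrix_mul_assoc[symmetric] that linear_0[OF linear_matrix_mult])
    finally show ?thesis by (simp add: linear_0[OF linear_matrix_mult])
  qed
  \<comment> \<open>The source condition and the growth bound do not mention a decomposition, so any
    single one serves for them.\<close>
  obtain r U \<Sigma> V where svd: "compact_svd X0 r U \<Sigma> V" using ex_compact_svd by blast
  then interpret svd_factors X0 r U \<Sigma> V by unfold_locales

  show "{X. \<Phi> X = 0} \<inter> sym_sandwiches (rank X0) U0 V0 = {0}"
    if "compact_svd X0 (rank X0) U0 \<Sigma>0 V0" for U0 \<Sigma>0 V0
  proof -
    have "X = 0" if "X \<in> sym_sandwiches (rank X0) U0 V0" "L ** X = 0" for X
    proof -
      have "P ** X = X"
        using that(1) svd_factors.left_identity_sandwich[OF svd_factors.intro PX0]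
          \<open>compact_svd X0 (rank X0) U0 \<Sigma>0 V0\<close>
        by (auto simp: sym_sandwiches_def)
      moreover have "P ** X = 0"
        by (simp add: P_def matrix_mul_assoc[symmetric] that(2) linear_0[OF linear_matrix_mult])
      ultimately show ?thesis by simp
    qed
    moreover have "0 \<in> sym_sandwiches (rank X0) U0 V0"
      by (auto simp: sym_sandwiches_def sandwich_def vec_eq_iff intro!: exI[of _ "\<lambda>_ _. 0"])
    ultimately show ?thesis by (auto simp: assms(2))
  qed

  have "adjoint \<Phi> = (\<lambda>Y. transpose L ** Y)"
    by (rule adjoint_unique) (simp add: assms(2) inner_matrix_mult)
  \<comment> \<open>Transposing the symmetric \<open>P = pinv L ** L\<close>, which fixes the polar
    factor, exhibits a preimage under the adjoint.\<close>
  moreover have "polar_factor = transpose L ** (transpose (pinv L) ** polar_factor)"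
    using left_identity_polar_factor[OF PX0] P_sym
    by (simp add: P_def matrix_transpose_mul matrix_mul_assoc)
  ultimately have "polar_factor \<in> range (adjoint \<Phi>)" by (metis rangeI)
  with polar_factor_in_rel_interior
  show "range (adjoint \<Phi>) \<inter> rel_interior (subdifferential nuclear_norm X0) \<noteq> {}" by blast

  define N where "N = nuclear_norm X0"
  have N: "N \<ge> 0" by (simp add: N_def nuclear_norm_nonneg)
  have growth: "nuclear_norm X \<ge> sqrt (N\<^sup>2 + (norm (X - X0))\<^sup>2)" if "\<Phi> X = M0" for X
    using nuclear_norm_add_ge[OF orth, of "X - X0"] that LX0
    by (simp add: N_def assms(2) linear_diff[OF linear_matrix_mult])

  \<comment> \<open>Chosen so that \<open>2 * N * c + c = 1\<close>: in
    \<open>(N + c * h\<^sup>2)\<^sup>2\<close> the cross term then leaves room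
    \<open>c * h\<^sup>2\<close>, which absorbs \<open>(c\<^sup>2 * h\<^sup>2) * h\<^sup>2\<close>
    for \<open>h \<le> 1\<close>.\<close>
  define c where "c = 1 / (2 * N + 1)"
  have c: "0 < c" "c \<le> 1" "2 * N * c = 1 - c"
    using N by (auto simp: c_def field_simps)
  have quadratic: "nuclear_norm X - nuclear_norm X0 \<ge> c * (norm (X - X0))\<^sup>2"
    if "\<Phi> X = M0" "norm (X - X0) \<le> 1" for X
  proof -
    define h where "h = norm (X - X0)"
    have h: "0 \<le> h" "h \<le> 1"
      using that(2) by (auto simp: h_def)
    have "c\<^sup>2 * h\<^sup>2 \<le> c * 1"
      using h c by (intro mult_mono) (auto simp: power2_eq_square mult_le_one)
    then have "(c\<^sup>2 * h\<^sup>2) * h\<^sup>2 \<le> c * h\<^sup>2"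
      using mult_right_mono[of "c\<^sup>2 * h\<^sup>2" c "h\<^sup>2"] by simp
    moreover have "(N + c * h\<^sup>2)\<^sup>2 = N\<^sup>2 + (2 * N * c) * h\<^sup>2 + (c\<^sup>2 * h\<^sup>2) * h\<^sup>2"
      by (simp add: power2_eq_square algebra_simps)
    ultimately have "(N + c * h\<^sup>2)\<^sup>2 \<le> N\<^sup>2 + h\<^sup>2"
      unfolding c(3) left_diff_distrib by linarith
    then have "N + c * h\<^sup>2 \<le> sqrt (N\<^sup>2 + h\<^sup>2)" by (rule real_le_rsqrt)
    with growth[OF that(1)] show ?thesis
      by (simp add: h_def N_def)
  qed
  show "strong_solution nuclear_norm {X. \<Phi> X = M0} X0"
    unfolding strong_solution_def using LX0 c(1) quadratic zero_less_one
    by (metis (mono_tags, lifting) assms(2) mem_Collect_eq)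

  \<comment> \<open>The growth bound makes \<open>X0\<close> the strict global minimiser, so by
    convexity the norm falls along the segment from any other feasible \<open>X\<close> to
    \<open>X0\<close>, against local minimality of \<open>X\<close>.\<close>
  show "X = X0" if strong: "strong_solution nuclear_norm {X. \<Phi> X = M0} X" for X
  proof (rule ccontr)
    assume "X \<noteq> X0"
    obtain c \<epsilon> where \<Phi>X: "\<Phi> X = M0" and "c > 0" "\<epsilon> > 0"
      and min: "\<And>Y. \<Phi> Y = M0 \<Longrightarrow> norm (Y - X) \<le> \<epsilon> \<Longrightarrow>
        nuclear_norm Y - nuclear_norm X \<ge> c * (norm (Y - X))\<^sup>2"
      using strong by (auto simp: strong_solution_def)
    have "N < sqrt (N\<^sup>2 + (norm (X - X0))\<^sup>2)"
      using \<open>X \<noteq> X0\<close> by (intro real_less_rsqrt) simp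
    with growth[OF \<Phi>X] have less: "nuclear_norm X0 < nuclear_norm X" by (simp add: N_def)
    \<comment> \<open>The truncation keeps \<open>Y\<close> on the segment from \<open>X\<close> to
      \<open>X0\<close> and within distance \<open>\<epsilon>\<close> of \<open>X\<close>.\<close>
    define t where "t = min 1 (\<epsilon> / norm (X0 - X))"
    have t: "0 < t" "t \<le> 1" and le: "t * norm (X0 - X) \<le> \<epsilon>"
      using \<open>\<epsilon> > 0\<close> \<open>X \<noteq> X0\<close> by (auto simp: t_def min_def field_simps)
    define Y where "Y = X + t *\<^sub>R (X0 - X)"
    have "\<Phi> Y = M0"
      using \<Phi>X LX0 by (simp add: Y_def assms(2) linear_add[OF linear_matrix_mult]
          linear_diff[OF linear_matrix_mult] linear_scale[OF linear_matrix_mult])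
    moreover have "norm (Y - X) \<le> \<epsilon>"
      using le t by (simp add: Y_def)
    ultimately have "nuclear_norm Y - nuclear_norm X \<ge> c * (norm (Y - X))\<^sup>2" by (rule min)
    moreover have "c * (norm (Y - X))\<^sup>2 \<ge> 0" using \<open>c > 0\<close> by simp
    ultimately have "nuclear_norm X \<le> nuclear_norm Y" by linarith
    \<comment> \<open>A single \<open>S\<close> attaining the norm at \<open>Y\<close> yields
      convexity along the segment.\<close>
    obtain S where S: "contraction S" "S \<bullet> Y = nuclear_norm Y"
      by (rule ex_contraction_inner_eq_nuclear_norm)
    note \<open>nuclear_norm X \<le> nuclear_norm Y\<close>
    also have "nuclear_norm Y = (1 - t) * (S \<bullet> X) + t * (S \<bullet> X0)"
      unfolding S(2)[symmetric] by (simp add: Y_def inner_add inner_diff algebra_simps)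
    also have "\<dots> \<le> (1 - t) * nuclear_norm X + t * nuclear_norm X0"
      using t contraction_inner_le_nuclear_norm[OF S(1)] by (intro add_mono mult_left_mono) auto
    also have "\<dots> < (1 - t) * nuclear_norm X + t * nuclear_norm X"
      using t less by simp
    also have "\<dots> = nuclear_norm X" by (simp add: algebra_simps)
    finally show False by simp
  qed
qed

end
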